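(* Let $G$ be a $2$-colored complete graph (on a finite vertex set) such that $G$ contains no monochromatic induced $C_4$ and $G$ contains no $K_5^*$ (as defined in the context). Then $V(G)$ can be partitioned into two sets $R$ and $B$ such that every edge inside $R$ is red and every edge inside $B$ is blue (i.e., $R$ spans a red clique and $B$ spans a blue clique; either set may be empty or a single vertex).
   Context: A $2$-colored complete graph is a complete graph in which each edge receives the color red, the color blue, or both colors. Equivalently, it is the union of a red graph and a blue graph on the same vertex set whose union is complete. An edge having only one color is called pure (pure red or pure blue). A monochromatic induced $C_4$ in a color (say red) means four vertices $a,b,c,d$ such that $ab,bc,cd,da$ are red and the two diagonals $ac,bd$ are not red (i.e., are pure blue); similarly for blue. $K_5^*$ denotes the $2$-colored $K_5$ in which every edge is pure and both the red edges and the blue edges form a cycle $C_5$; "$G$ contains no $K_5^*$" means no five vertices of $G$ span such a configuration. A red clique is a vertex set all of whose pairs are red edges (possibly also blue); empty sets and single vertices count as cliques. *)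

theory Defs
  imports "HOL-Library.Ramsey"
begin

text \<open>Undirected edges are two-element sets of vertices. An edge may have both colors, so
  \<open>red\<close> and \<open>blue\<close> need not be disjoint.\<close>

locale two_colored_complete_graph =
  fixes V :: "'a set" and red blue :: "'a set set"
  assumes finite_V: "finite V"
    and edges: "red \<union> blue = nsets V 2"

definition has_induced_C4 :: "'a set \<Rightarrow> 'a set set \<Rightarrow> bool" where
  "has_induced_C4 V E \<longleftrightarrow>
     (\<exists>a b c d. distinct [a, b, c, d] \<and> {a, b, c, d} \<subseteq> V \<and>
        {a, b} \<in> E \<and> {b, c} \<in> E \<and> {c, d} \<in> E \<and> {d, a} \<in> E \<and>
        {a, c} \<notin> E \<and> {b, d} \<notin> E)"

definition spans_C5 :: "'a set \<Rightarrow> 'a set set \<Rightarrow> bool" where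
  "spans_C5 S E \<longleftrightarrow>
     (\<exists>a b c d e. distinct [a, b, c, d, e] \<and> S = {a, b, c, d, e} \<and>
        E \<inter> nsets S 2 = {{a, b}, {b, c}, {c, d}, {d, e}, {e, a}})"

definition has_K5_star :: "'a set \<Rightarrow> 'a set set \<Rightarrow> 'a set set \<Rightarrow> bool" where
  "has_K5_star V red blue \<longleftrightarrow>
     (\<exists>S \<subseteq> V. card S = 5 \<and> red \<inter> blue \<inter> nsets S 2 = {} \<and>
        spans_C5 S red \<and> spans_C5 S blue)"

end

theory Submission
  imports Defs
begin

text \<open>Let \<open>h\<close> and \<open>k\<close> be the graphs of pure blue and pure red edges: each is free of induced \<open>2K\<^sub>2\<close>,
  and \<open>V\<close> has to be split into an \<open>h\<close>-independent part \<open>R\<close> and a \<open>k\<close>-independent part \<open>B\<close>.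
  Induct on the number of vertices. Given a partition \<open>R, B\<close> of \<open>V - {v}\<close>, try to put \<open>v\<close> into \<open>R\<close>:
  move the \<open>h\<close>-neighbours of \<open>v\<close> in \<open>R\<close> to \<open>B\<close>, and then the \<open>k\<close>-neighbours of these in \<open>B\<close> to \<open>R\<close>.
  As \<open>h\<close> and \<open>k\<close> are \<open>2K\<^sub>2\<close>-free, this fails only if \<open>v\<close> lies in a triangle \<open>v x y\<close> with \<open>vx, vy\<close> in
  \<open>h\<close> and \<open>xy\<close> in \<open>k\<close>. Symmetrically, if \<open>v\<close> cannot be put into \<open>B\<close>, it lies in a triangle \<open>v z w\<close>
  with \<open>vz, vw\<close> in \<open>k\<close> and \<open>zw\<close> in \<open>h\<close>. These two triangles together span a \<open>K\<^sub>5\<^sup>*\<close>.\<close>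

text \<open>Distinctness of \<open>a, b, c, d\<close> need not be required: for two edges of a symmetric relation that
  share a vertex the conclusion holds trivially.\<close>

definition two_K2_free :: "('a \<Rightarrow> 'a \<Rightarrow> bool) \<Rightarrow> bool" where
  "two_K2_free r \<longleftrightarrow>
     (\<forall>a b c d. r a b \<longrightarrow> r c d \<longrightarrow> r a c \<or> r a d \<or> r b c \<or> r b d)"

lemma two_K2_freeD:
  "two_K2_free r \<Longrightarrow> r a b \<Longrightarrow> r c d \<Longrightarrow> r a c \<or> r a d \<or> r b c \<or> r b d"
  unfolding two_K2_free_def by blast

definition independent_in :: "('a \<Rightarrow> 'a \<Rightarrow> bool) \<Rightarrow> 'a set \<Rightarrow> bool" where
  "independent_in r S \<longleftrightarrow> (\<forall>x\<in>S. \<forall>y\<in>S. \<not> r x y)"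

locale disjoint_two_K2_free =
  fixes h k :: "'a \<Rightarrow> 'a \<Rightarrow> bool"
  assumes sym_h: "h x y \<Longrightarrow> h y x"
    and sym_k: "k x y \<Longrightarrow> k y x"
    and irrefl_h: "\<not> h x x"
    and irrefl_k: "\<not> k x x"
    and disjoint: "h x y \<Longrightarrow> \<not> k x y"
    and free_h: "two_K2_free h"
    and free_k: "two_K2_free k"
begin

lemma swap: "disjoint_two_K2_free k h"
  by unfold_locales (use sym_h sym_k irrefl_h irrefl_k disjoint free_h free_k in blast)+

text \<open>The \<open>h\<close>-edges \<open>va\<close>, \<open>bc\<close> force
  \<open>h a c\<close>, and \<open>dv\<close>, \<open>bc\<close> force \<open>h d b\<close>; then no
  pair is left to join the \<open>k\<close>-edges \<open>ab\<close>, \<open>cd\<close>.\<close>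

lemma alternating_5_walk:
  assumes no_triangle: "\<And>x y. h v x \<Longrightarrow> h v y \<Longrightarrow> \<not> k x y"
    and walk: "h v a" "k a b" "h b c" "k c d" "h d v"
  shows False
proof -
  have "h a c"
    using two_K2_freeD[OF free_h walk(1,3)] walk no_triangle disjoint sym_h sym_k by blast
  moreover have "h d b"
    using two_K2_freeD[OF free_h walk(5,3)] walk no_triangle disjoint sym_h sym_k by blast
  ultimately show False
    using two_K2_freeD[OF free_k walk(2,4)] walk no_triangle disjoint sym_h sym_k by blast
qed

lemma extend_partition:
  assumes part: "R \<union> B = W" "R \<inter> B = {}" and v: "v \<notin> W"
    and R: "independent_in h R" and B: "independent_in k B"
    and no_triangle: "\<And>x y. h v x \<Longrightarrow> h v y \<Longrightarrow> \<not> k x y"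
  shows "\<exists>R' B'. R' \<union> B' = insert v W \<and> R' \<inter> B' = {} \<and>
    independent_in h R' \<and> independent_in k B'"
proof -
  define A where "A = {a \<in> R. h v a}"
  define C where "C = {b \<in> B. \<exists>a\<in>A. k a b}"
  \<comment> \<open>An \<open>h\<close>-edge \<open>c c'\<close> would close a walk
    \<open>v a c c' a' v\<close> with \<open>a\<close>, \<open>a'\<close> in
    \<open>A\<close>.\<close>
  have CC: "\<not> h c c'" if "c \<in> C" "c' \<in> C" for c c'
    using that alternating_5_walk[OF no_triangle] sym_h sym_k unfolding A_def C_def by blast
  have vC: "\<not> h v c" if "c \<in> C" for c
    using that no_triangle unfolding A_def C_def by blast
  have RC: "\<not> h r c" if "r \<in> R - A" "c \<in> C" for r c
  proof
    assume "h r c"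
    obtain a where a: "a \<in> R" "h v a" "k a c"
      using \<open>c \<in> C\<close> unfolding A_def C_def by blast
    have "h v r \<or> h v c \<or> h a r \<or> h a c"
      using two_K2_freeD[OF free_h a(2) \<open>h r c\<close>] .
    then show False
      using that a vC disjoint R unfolding A_def independent_in_def by blast
  qed
  have "independent_in h (insert v (R - A) \<union> C)"
    using R CC vC RC sym_h irrefl_h unfolding independent_in_def A_def by blast
  \<comment> \<open>All of \<open>A\<close> is \<open>h\<close>-adjacent to \<open>v\<close>, so
    \<open>A\<close> contains no \<open>k\<close>-edge; every \<open>k\<close>-edge from
    \<open>A\<close> to \<open>B\<close> ends in \<open>C\<close>.\<close>
  moreover have "independent_in k ((B - C) \<union> A)"
    using B no_triangle sym_k unfolding independent_in_def A_def C_def by blast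
  moreover have "(insert v (R - A) \<union> C) \<union> ((B - C) \<union> A) = insert v W"
    "(insert v (R - A) \<union> C) \<inter> ((B - C) \<union> A) = {}"
    using part v unfolding A_def C_def by blast+
  ultimately show ?thesis
    by blast
qed

text \<open>Each of \<open>x\<close>, \<open>y\<close> has an \<open>h\<close>-neighbour among
  \<open>z\<close>, \<open>w\<close>, and each of \<open>z\<close>, \<open>w\<close> a
  \<open>k\<close>-neighbour among \<open>x\<close>, \<open>y\<close>. By disjointness the four
  cross pairs split into an \<open>h\<close>-matching and a \<open>k\<close>-matching;
  \<open>z'\<close> is the \<open>h\<close>-partner of \<open>x\<close>.\<close>

lemma triangles_yield_C5:
  assumes "h v x" "h v y" "k x y" "k v z" "k v w" "h z w"
  obtains z' w' where "h v x" "h x z'" "h z' w'" "h w' y" "h y v"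
    "k v z'" "k z' y" "k y x" "k x w'" "k w' v"
proof -
  have "h x z \<or> h x w" "h y z \<or> h y w"
    using two_K2_freeD[OF free_h sym_h[OF assms(1)] assms(6)]
      two_K2_freeD[OF free_h sym_h[OF assms(2)] assms(6)] assms(4,5) disjoint by blast+
  moreover have "k z x \<or> k z y" "k w x \<or> k w y"
    using two_K2_freeD[OF free_k sym_k[OF assms(4)] assms(3)]
      two_K2_freeD[OF free_k sym_k[OF assms(5)] assms(3)] assms(1,2) disjoint by blast+
  ultimately have "h x z \<and> k z y \<and> h y w \<and> k x w \<or> h x w \<and> k w y \<and> h y z \<and> k x z"
    using sym_h sym_k disjoint by blast
  then show thesis
    using that assms sym_h sym_k by blast
qed

lemma partition:
  assumes no_C5: "\<And>a b c d e. \<not> (h a b \<and> h b c \<and> h c d \<and> h d e \<and> h e a \<and>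
      k a c \<and> k c e \<and> k e b \<and> k b d \<and> k d a)"
    and "finite V"
  shows "\<exists>R B. R \<union> B = V \<and> R \<inter> B = {} \<and> independent_in h R \<and> independent_in k B"
  using \<open>finite V\<close>
proof induction
  case empty
  then show ?case by (simp add: independent_in_def)
next
  case (insert v W)
  then obtain R B where RB: "R \<union> B = W" "R \<inter> B = {}" "independent_in h R" "independent_in k B"
    by blast
  consider "\<And>x y. h v x \<Longrightarrow> h v y \<Longrightarrow> \<not> k x y" | "\<And>x y. k v x \<Longrightarrow> k v y \<Longrightarrow> \<not> h x y"
  proof (cases "\<exists>x y. h v x \<and> h v y \<and> k x y")
    case True
    then obtain x y where xy: "h v x" "h v y" "k x y" by blast
    have "\<not> h z w" if zw: "k v z" "k v w" for z w
    proof
      assume "h z w"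
      obtain z' w' where "h v x" "h x z'" "h z' w'" "h w' y" "h y v"
        "k v z'" "k z' y" "k y x" "k x w'" "k w' v"
        by (rule triangles_yield_C5[OF xy zw \<open>h z w\<close>])
      then show False
        using no_C5[of v x z' w' y] by simp
    qed
    then show ?thesis using that(2) by blast
  qed (use that(1) in blast)
  then show ?case
  proof cases
    case 1
    then show ?thesis
      using extend_partition[OF RB(1,2) insert.hyps(2) RB(3,4)] by blast
  next
    case 2
    then have "\<exists>B' R'. B' \<union> R' = insert v W \<and> B' \<inter> R' = {} \<and>
      independent_in k B' \<and> independent_in h R'"
      by (intro disjoint_two_K2_free.extend_partition[OF swap, of B R])
        (use RB insert.hyps(2) in blast)+
    then obtain B' R' where "B' \<union> R' = insert v W" "B' \<inter> R' = {}"
      "independent_in k B'" "independent_in h R'"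
      by blast
    then show ?thesis
      by (intro exI[of _ R'] exI[of _ B']) (simp add: Un_commute Int_commute)
  qed
qed

end

lemma spans_C5I:
  assumes "distinct [a, b, c, d, e]" and "S = {a, b, c, d, e}"
    and "E \<inter> nsets S 2 = {{a, b}, {b, c}, {c, d}, {d, e}, {e, a}}"
  shows "spans_C5 S E"
  unfolding spans_C5_def using assms by (intro exI conjI)

context two_colored_complete_graph
begin

lemma swap_colors: "two_colored_complete_graph V blue red"
  by unfold_locales (use finite_V edges in auto)

lemma mem_edges: "{x, y} \<in> red \<union> blue \<longleftrightarrow> x \<in> V \<and> y \<in> V \<and> x \<noteq> y"
  unfolding edges by (auto simp: nsets_def card_2_iff doubleton_eq_iff)

text \<open>Pure blue edges \<open>ab\<close>, \<open>cd\<close> violating this would be the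
  diagonals of an induced red cycle \<open>a c b d\<close>; if they shared a vertex, some cross pair
  would itself be pure blue.\<close>

lemma pure_blue_two_K2_free:
  assumes "\<not> has_induced_C4 V red"
  shows "two_K2_free (\<lambda>x y. {x, y} \<in> blue - red)"
  unfolding two_K2_free_def
proof (intro allI impI, rule ccontr)
  fix a b c d
  assume ab: "{a, b} \<in> blue - red" and cd: "{c, d} \<in> blue - red"
    and no: "\<not> ({a, c} \<in> blue - red \<or> {a, d} \<in> blue - red \<or>
      {b, c} \<in> blue - red \<or> {b, d} \<in> blue - red)"
  have dist: "distinct [a, c, b, d]"
    using ab cd no mem_edges by (auto simp: insert_commute)
  have in_V: "{a, c, b, d} \<subseteq> V"
    using ab cd mem_edges by auto
  have "{a, c} \<in> red" "{c, b} \<in> red" "{b, d} \<in> red" "{d, a} \<in> red"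
    using no dist in_V mem_edges[of a c] mem_edges[of b c] mem_edges[of b d] mem_edges[of a d]
    by (auto simp: insert_commute)
  then show False
    using assms ab cd dist in_V unfolding has_induced_C4_def by blast
qed

lemma pure_C5_has_K5_star:
  assumes "{a, b} \<in> blue - red \<and> {b, c} \<in> blue - red \<and> {c, d} \<in> blue - red \<and>
    {d, e} \<in> blue - red \<and> {e, a} \<in> blue - red \<and>
    {a, c} \<in> red - blue \<and> {c, e} \<in> red - blue \<and> {e, b} \<in> red - blue \<and>
    {b, d} \<in> red - blue \<and> {d, a} \<in> red - blue"
  shows "has_K5_star V red blue"
proof -
  define S where "S = {a, b, c, d, e}"
  have dist: "distinct [a, b, c, d, e]" and "S \<subseteq> V"
    using assms mem_edges unfolding S_def by auto
  \<comment> \<open>A 5-cycle and its complementary 5-cycle exhaust the ten pairs in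
    \<open>S\<close>.\<close>
  have pairs: "nsets S 2 = {{a, b}, {b, c}, {c, d}, {d, e}, {e, a}} \<union>
      {{a, c}, {c, e}, {e, b}, {b, d}, {d, a}}"
    using dist unfolding S_def nsets_2_eq
    by (simp add: insert_Diff_if insert_commute)
  have "spans_C5 S blue"
  proof (rule spans_C5I)
    show "blue \<inter> nsets S 2 = {{a, b}, {b, c}, {c, d}, {d, e}, {e, a}}"
      unfolding pairs using assms by blast
  qed (use dist S_def in auto)
  moreover have "spans_C5 S red"
  proof (rule spans_C5I)
    show "red \<inter> nsets S 2 = {{a, c}, {c, e}, {e, b}, {b, d}, {d, a}}"
      unfolding pairs using assms by blast
  qed (use dist S_def in auto)
  moreover have "card S = 5"
    using dist unfolding S_def by simp
  moreover have "red \<inter> blue \<inter> nsets S 2 = {}"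
    unfolding pairs using assms by blast
  ultimately show ?thesis
    unfolding has_K5_star_def using \<open>S \<subseteq> V\<close> by blast
qed

end

theorem theorem4:
  fixes V :: "'a set" and red blue :: "'a set set"
  assumes "two_colored_complete_graph V red blue"
    and "\<not> has_induced_C4 V red"
    and "\<not> has_induced_C4 V blue"
    and "\<not> has_K5_star V red blue"
  shows "\<exists>R B. R \<union> B = V \<and> R \<inter> B = {} \<and> clique R red \<and> clique B blue"
proof -
  interpret two_colored_complete_graph V red blue by fact
  let ?h = "\<lambda>x y. {x, y} \<in> blue - red" and ?k = "\<lambda>x y. {x, y} \<in> red - blue"
  interpret pure: disjoint_two_K2_free ?h ?k
  proof
    show "two_K2_free ?h"
      using assms(2) by (rule pure_blue_two_K2_free)
    show "two_K2_free ?k"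
      using swap_colors assms(3) by (rule two_colored_complete_graph.pure_blue_two_K2_free)
  qed (use mem_edges[of x x for x] in \<open>auto simp: insert_commute\<close>)
  have "\<exists>R B. R \<union> B = V \<and> R \<inter> B = {} \<and> independent_in ?h R \<and> independent_in ?k B"
    by (rule pure.partition[OF contrapos_nn[OF assms(4) pure_C5_has_K5_star] finite_V])
  then obtain R B where
    RB: "R \<union> B = V" "R \<inter> B = {}" "independent_in ?h R" "independent_in ?k B"
    by blast
  \<comment> \<open>By completeness, a pair that is not pure blue is red, and one that is not pure
    red is blue.\<close>
  moreover have "{x, y} \<in> red \<union> blue" if "x \<in> V" "y \<in> V" "x \<noteq> y" for x y
    using that mem_edges by simp
  ultimately have "clique R red" "clique B blue"
    unfolding clique_def independent_in_def by blast+
  then show ?thesis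
    using RB by blast
qed

end
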